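(* Let $n,k\geq 2$. Then $(\iota_n)_{\#k}\colon\pi_k(F_n(\mathbb{R}P^2))\to\pi_k(\prod_1^n\mathbb{R}P^2)$ is a diagonal homomorphism.
   Context: $F_n(\mathbb{R}P^2)$ is the $n$th configuration space of $\mathbb{R}P^2$ (pairwise distinct $n$-tuples), $\iota_n\colon F_n(\mathbb{R}P^2)\to\prod_1^n\mathbb{R}P^2$ is the inclusion, and $(\iota_n)_{\#k}$ is the induced homomorphism on $\pi_k$. Let $p_i\colon F_n(\mathbb{R}P^2)\to\mathbb{R}P^2$ be the projection onto the $i$th coordinate. "$(\iota_n)_{\#k}$ is diagonal" means that $(p_i)_{\#k}=(p_j)_{\#k}$ for all $1\le i<j\le n$, the groups $\pi_k(\mathbb{R}P^2)$ at different basepoints being identified by change of basepoint. *)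

theory Defs
  imports "HOL-Analysis.Analysis" "HOL-Algebra.Group"
begin

abbreviation S2 :: "(real^3) set" where
  "S2 \<equiv> sphere 0 1"

definition antipodal_class :: "real^3 \<Rightarrow> (real^3) set" where
  "antipodal_class v = {v, - v}"

definition RP2 :: "(real^3) set topology" where
  "RP2 = topology (\<lambda>U. U \<subseteq> antipodal_class ` S2 \<and>
                       openin (top_of_set S2) {v \<in> S2. antipodal_class v \<in> U})"

lemma openin_RP2:
  "openin RP2 U \<longleftrightarrow> U \<subseteq> antipodal_class ` S2 \<and>
     openin (top_of_set S2) {v \<in> S2. antipodal_class v \<in> U}"
proof -
  have "istopology (\<lambda>U. U \<subseteq> antipodal_class ` S2 \<and>
                       openin (top_of_set S2) {v \<in> S2. antipodal_class v \<in> U})"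
    unfolding istopology_def
  proof (intro conjI allI impI)
    fix U V
    assume U: "U \<subseteq> antipodal_class ` S2 \<and> openin (top_of_set S2) {v \<in> S2. antipodal_class v \<in> U}"
      and V: "V \<subseteq> antipodal_class ` S2 \<and> openin (top_of_set S2) {v \<in> S2. antipodal_class v \<in> V}"
    show "U \<inter> V \<subseteq> antipodal_class ` S2"
      using U by blast
    have eq: "{v \<in> S2. antipodal_class v \<in> U \<inter> V} =
        {v \<in> S2. antipodal_class v \<in> U} \<inter> {v \<in> S2. antipodal_class v \<in> V}"
      by blast
    show "openin (top_of_set S2) {v \<in> S2. antipodal_class v \<in> U \<inter> V}"
      unfolding eq by (rule openin_Int[OF conjunct2[OF U] conjunct2[OF V]])
  next
    fix \<U>
    assume *: "\<forall>U\<in>\<U>. U \<subseteq> antipodal_class ` S2 \<and>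
                 openin (top_of_set S2) {v \<in> S2. antipodal_class v \<in> U}"
    then show "\<Union>\<U> \<subseteq> antipodal_class ` S2"
      by blast
    have eq: "{v \<in> S2. antipodal_class v \<in> \<Union>\<U>} = (\<Union>U\<in>\<U>. {v \<in> S2. antipodal_class v \<in> U})"
      by blast
    show "openin (top_of_set S2) {v \<in> S2. antipodal_class v \<in> \<Union>\<U>}"
      unfolding eq by (rule openin_Union) (use * in blast)
  qed
  then show ?thesis
    by (simp add: RP2_def topology_inverse')
qed

lemma topspace_RP2: "topspace RP2 = antipodal_class ` S2"
proof
  show "topspace RP2 \<subseteq> antipodal_class ` S2"
    using openin_RP2 openin_topspace by blast
  have "{v \<in> S2. antipodal_class v \<in> antipodal_class ` S2} = S2"
    by blast
  then have "openin RP2 (antipodal_class ` S2)"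
    by (simp add: openin_RP2)
  then show "antipodal_class ` S2 \<subseteq> topspace RP2"
    by (rule openin_subset)
qed

lemma quotient_map_antipodal_class: "quotient_map (top_of_set S2) RP2 antipodal_class"
  unfolding quotient_map_def topspace_RP2 openin_RP2 topspace_euclidean_subtopology by blast

lemma path_connected_space_RP2: "path_connected_space RP2"
proof -
  have "path_connected S2"
    by (rule path_connected_sphere) simp
  then have "path_connected_space (top_of_set S2)"
    using path_connectedin_euclidean path_connectedin_def by blast
  then show ?thesis
    by (rule path_connected_space_quotient_map_image[OF quotient_map_antipodal_class])
qed

text \<open>The product of \<open>n\<close> copies of \<open>X\<close>; its points are the extensional functions on \<open>{1..n}\<close>.\<close>

definition power_space :: "nat \<Rightarrow> 'a topology \<Rightarrow> (nat \<Rightarrow> 'a) topology" where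
  "power_space n X = product_topology (\<lambda>_. X) {1..n}"

definition config_space :: "nat \<Rightarrow> 'a topology \<Rightarrow> (nat \<Rightarrow> 'a) topology" where
  "config_space n X = subtopology (power_space n X) {x. inj_on x {1..n}}"

definition cube :: "nat \<Rightarrow> (nat \<Rightarrow> real) topology" where
  "cube k = power_space k (top_of_set {0..1})"

definition cube_boundary :: "nat \<Rightarrow> (nat \<Rightarrow> real) set" where
  "cube_boundary k = {t \<in> topspace (cube k). \<exists>i\<in>{1..k}. t i = 0 \<or> t i = 1}"

definition spheroids :: "nat \<Rightarrow> 'a topology \<Rightarrow> 'a \<Rightarrow> ((nat \<Rightarrow> real) \<Rightarrow> 'a) set" where
  "spheroids k X x = {f. continuous_map (cube k) X f \<and> f ` cube_boundary k \<subseteq> {x}}"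

text \<open>The homotopy class of \<open>f\<close> among maps \<open>(I\<^sup>k, \<partial>I\<^sup>k) \<rightarrow> (X, x)\<close>. Values of functions off the cube
  are irrelevant: maps that agree on the cube lie in the same class.\<close>

definition pi_class ::
    "nat \<Rightarrow> 'a topology \<Rightarrow> 'a \<Rightarrow> ((nat \<Rightarrow> real) \<Rightarrow> 'a) \<Rightarrow> ((nat \<Rightarrow> real) \<Rightarrow> 'a) set" where
  "pi_class k X x f = {g. homotopic_with (\<lambda>h. h ` cube_boundary k \<subseteq> {x}) (cube k) X f g}"

definition juxtapose ::
    "((nat \<Rightarrow> real) \<Rightarrow> 'a) \<Rightarrow> ((nat \<Rightarrow> real) \<Rightarrow> 'a) \<Rightarrow> (nat \<Rightarrow> real) \<Rightarrow> 'a" where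
  "juxtapose f g t = (if t 1 \<le> 1/2 then f (t(1 := 2 * t 1)) else g (t(1 := 2 * t 1 - 1)))"

text \<open>Operations on classes are written as unions over representatives. For \<open>k \<ge> 1\<close> all the
  classes in such a union coincide.\<close>

definition pi_group ::
    "nat \<Rightarrow> 'a topology \<Rightarrow> 'a \<Rightarrow> ((nat \<Rightarrow> real) \<Rightarrow> 'a) set monoid" where
  "pi_group k X x =
     \<lparr>carrier = pi_class k X x ` spheroids k X x,
      monoid.mult = (\<lambda>A B. \<Union>f\<in>A. \<Union>g\<in>B. pi_class k X x (juxtapose f g)),
      one = pi_class k X x (\<lambda>_. x)\<rparr>"

definition pi_map ::
    "nat \<Rightarrow> 'b topology \<Rightarrow> ('a \<Rightarrow> 'b) \<Rightarrow> 'a \<Rightarrow> ((nat \<Rightarrow> real) \<Rightarrow> 'a) set \<Rightarrow> ((nat \<Rightarrow> real) \<Rightarrow> 'b) set" where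
  "pi_map k Y \<phi> x A = (\<Union>f\<in>A. pi_class k Y (\<phi> x) (\<phi> \<circ> f))"

lemma pi_map_pi_class:
  assumes "continuous_map X Y \<phi>" "f \<in> spheroids k X x"
  shows "pi_map k Y \<phi> x (pi_class k X x f) = pi_class k Y (\<phi> x) (\<phi> \<circ> f)"
proof -
  have f: "f \<in> pi_class k X x f"
    using assms(2) by (simp add: pi_class_def spheroids_def)
  have "pi_class k Y (\<phi> x) (\<phi> \<circ> g) = pi_class k Y (\<phi> x) (\<phi> \<circ> f)" if "g \<in> pi_class k X x f" for g
  proof -
    have "homotopic_with (\<lambda>h. h ` cube_boundary k \<subseteq> {x}) (cube k) X f g"
      using that by (simp add: pi_class_def)
    then have "homotopic_with (\<lambda>h. h ` cube_boundary k \<subseteq> {\<phi> x}) (cube k) Y (\<phi> \<circ> f) (\<phi> \<circ> g)"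
      by (rule homotopic_with_compose_continuous_map_left[OF _ assms(1)]) auto
    then show ?thesis
      unfolding pi_class_def set_eq_iff mem_Collect_eq
      by (meson homotopic_with_symD homotopic_with_trans)
  qed
  then show ?thesis
    using f unfolding pi_map_def by blast
qed

definition cube_norm :: "nat \<Rightarrow> (nat \<Rightarrow> real) \<Rightarrow> real" where
  "cube_norm k t = Max ((\<lambda>i. \<bar>2 * t i - 1\<bar>) ` {1..k})"

text \<open>For a path \<open>\<gamma>\<close> from \<open>x\<close> to \<open>y\<close> and a spheroid \<open>f\<close> at \<open>x\<close>, this is the spheroid at \<open>y\<close> that is
  \<open>f\<close> on the concentric cube of half the size and \<open>\<gamma>\<close> on each radial segment of the shell.\<close>

definition shell :: "nat \<Rightarrow> (real \<Rightarrow> 'a) \<Rightarrow> ((nat \<Rightarrow> real) \<Rightarrow> 'a) \<Rightarrow> (nat \<Rightarrow> real) \<Rightarrow> 'a" where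
  "shell k \<gamma> f t =
     (if cube_norm k t \<le> 1/2 then f (\<lambda>i\<in>{1..k}. 2 * t i - 1/2) else \<gamma> (2 * cube_norm k t - 1))"

definition change_basepoint ::
    "nat \<Rightarrow> 'a topology \<Rightarrow> (real \<Rightarrow> 'a) \<Rightarrow> ((nat \<Rightarrow> real) \<Rightarrow> 'a) set \<Rightarrow> ((nat \<Rightarrow> real) \<Rightarrow> 'a) set" where
  "change_basepoint k X \<gamma> A = (\<Union>f\<in>A. pi_class k X (\<gamma> 1) (shell k \<gamma> f))"

text \<open>The homomorphism induced on \<open>\<pi>\<^sub>k\<close> by the inclusion of \<open>config_space n X\<close> into \<open>power_space n X\<close>
  is diagonal at the basepoint \<open>x\<close>: all coordinate projections induce the same homomorphism. No
  path is singled out for the change of basepoint, so equality is required along every path.\<close>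

definition diagonal_on_pi :: "nat \<Rightarrow> nat \<Rightarrow> 'a topology \<Rightarrow> (nat \<Rightarrow> 'a) \<Rightarrow> bool" where
  "diagonal_on_pi n k X x \<longleftrightarrow>
     (\<forall>i j \<gamma>. 1 \<le> i \<and> i < j \<and> j \<le> n \<and> pathin X \<gamma> \<and> \<gamma> 0 = x i \<and> \<gamma> 1 = x j \<longrightarrow>
        (\<forall>A \<in> carrier (pi_group k (config_space n X) x).
           change_basepoint k X \<gamma> (pi_map k X (\<lambda>y. y i) x A) = pi_map k X (\<lambda>y. y j) x A))"

end

theory Submission
  imports Defs
begin

text \<open>Why the homomorphism is diagonal. Let \<open>f\<close> and \<open>g\<close> be the \<open>i\<close>-th and \<open>j\<close>-th coordinates of a spheroid
  in the configuration space of the projective plane. The cube is contractible, so \<open>f\<close> and \<open>g\<close> lift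
  through the antipodal double cover to maps \<open>u\<close> and \<open>v\<close> into the 2-sphere (\<open>lift_cube_RP2\<close>), and for
  \<open>k \<ge> 2\<close> the lifts are constant on the boundary of the cube because it is connected
  (\<open>connectedin_cube_boundary\<close>). Since \<open>f\<close> and \<open>g\<close> take different values at every point, \<open>u\<close> is nowhere
  equal to \<open>v\<close> and nowhere equal to \<open>- v\<close>. Two maps to a sphere that are nowhere antipodal are homotopic
  along great arcs; so \<open>u\<close> is freely homotopic both to \<open>v\<close> and to \<open>- v\<close>, both of which lie over \<open>g\<close>.

  To control basepoints, let \<open>\<gamma>\<close> be a path from the basepoint of \<open>f\<close> to that of \<open>g\<close>. Its lift from the
  basepoint of \<open>u\<close> ends at the basepoint of \<open>v\<close> or of \<open>- v\<close>; replace \<open>v\<close> by \<open>- v\<close> in the second case. As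
  the 2-sphere is simply connected, the lifted path is homotopic to a great arc, and then the
  spheroid \<open>u\<close> with this arc attached as a shell is nowhere antipodal to \<open>v\<close> with a constant shell
  (\<open>shell_homotopic_nowhere_antipodal\<close>). Projecting the homotopy to the projective plane shows that the
  change of basepoint along \<open>\<gamma>\<close> takes the class of \<open>f\<close> to the class of \<open>g\<close> (\<open>shell_RP2_homotopic\<close>). As
  both signs are allowed, this holds for every \<open>\<gamma>\<close>, although the fundamental group of the projective
  plane acts nontrivially on its second homotopy group.

  That the inclusion induces a homomorphism is an instance of functoriality (\<open>pi_map_hom\<close>), once
  juxtaposition is known to be well defined on homotopy classes (\<open>mult_pi_class\<close>).\<close>

section \<open>Cubes\<close>

lemma topspace_cube: "topspace (cube k) = {1..k} \<rightarrow>\<^sub>E {0..1}"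
  by (simp add: cube_def power_space_def)

lemma continuous_map_into_cube:
  "continuous_map Z (cube k) f \<longleftrightarrow>
     f \<in> topspace Z \<rightarrow> topspace (cube k) \<and> (\<forall>i\<in>{1..k}. continuous_map Z euclideanreal (\<lambda>z. f z i))"
  unfolding cube_def power_space_def continuous_map_componentwise
  by (auto simp: continuous_map_in_subtopology PiE_def Pi_def extensional_def)

lemma continuous_map_cube_coordinate:
  "i \<in> {1..k} \<Longrightarrow> continuous_map (cube k) euclideanreal (\<lambda>t. t i)"
  using continuous_map_into_cube[of "cube k" k id] by simp

lemma continuous_map_compose_coordinate:
  "continuous_map Z (cube k) f \<Longrightarrow> i \<in> {1..k} \<Longrightarrow> continuous_map Z euclideanreal (\<lambda>z. f z i)"
  by (simp add: continuous_map_into_cube)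

definition cube_segment :: "nat \<Rightarrow> (nat \<Rightarrow> real) \<Rightarrow> (nat \<Rightarrow> real) \<Rightarrow> real \<Rightarrow> nat \<Rightarrow> real" where
  "cube_segment k u v s = (\<lambda>i\<in>{1..k}. (1 - s) * u i + s * v i)"

lemma cube_segment_ends:
  assumes "u \<in> topspace (cube k)" "v \<in> topspace (cube k)"
  shows "cube_segment k u v 0 = u" "cube_segment k u v 1 = v"
  using assms by (auto simp: cube_segment_def topspace_cube fun_eq_iff PiE_def extensional_def)

lemma cube_segment_in_cube:
  assumes "u \<in> topspace (cube k)" "v \<in> topspace (cube k)" "s \<in> {0..1}"
  shows "cube_segment k u v s \<in> topspace (cube k)"
proof -
  have "(1 - s) * u i + s * v i \<in> {0..1}" if "i \<in> {1..k}" for i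
  proof -
    have "u i \<in> {0..1}" "v i \<in> {0..1}"
      using assms that unfolding topspace_cube by blast+
    then show ?thesis
      using assms(3) convex_bound_le[of "u i" 1 "v i" "1 - s" s] by simp
  qed
  then show ?thesis
    by (auto simp: cube_segment_def topspace_cube)
qed

lemma continuous_map_cube_segment:
  assumes "continuous_map Z (cube k) u" "continuous_map Z (cube k) v"
    and "continuous_map Z (top_of_set {0..1}) s"
  shows "continuous_map Z (cube k) (\<lambda>z. cube_segment k (u z) (v z) (s z))"
proof -
  have s: "continuous_map Z euclideanreal s" and s01: "\<And>z. z \<in> topspace Z \<Longrightarrow> s z \<in> {0..1}"
    using assms(3) by (auto simp: continuous_map_in_subtopology)
  have uv: "u z \<in> topspace (cube k)" "v z \<in> topspace (cube k)" if "z \<in> topspace Z" for z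
    using assms(1,2) that by (auto simp: continuous_map_into_cube)
  show ?thesis
    unfolding continuous_map_into_cube
  proof (intro conjI ballI)
    show "(\<lambda>z. cube_segment k (u z) (v z) (s z)) \<in> topspace Z \<rightarrow> topspace (cube k)"
      using uv s01 by (auto intro: cube_segment_in_cube)
    show "continuous_map Z euclideanreal (\<lambda>z. cube_segment k (u z) (v z) (s z) i)"
      if "i \<in> {1..k}" for i
      unfolding cube_segment_def restrict_apply'[OF that]
      by (intro continuous_intros s continuous_map_compose_coordinate[OF assms(1) that]
          continuous_map_compose_coordinate[OF assms(2) that])
  qed
qed

lemma cube_boundary_subset: "cube_boundary k \<subseteq> topspace (cube k)"
  by (auto simp: cube_boundary_def)

lemma cube_boundaryI:
  "t \<in> topspace (cube k) \<Longrightarrow> i \<in> {1..k} \<Longrightarrow> t i = 0 \<or> t i = 1 \<Longrightarrow> t \<in> cube_boundary k"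
  by (auto simp: cube_boundary_def)

lemma cube_segment_in_boundary:
  assumes "u \<in> topspace (cube k)" "v \<in> topspace (cube k)" "s \<in> {0..1}"
    and "i \<in> {1..k}" "u i = v i" "v i = 0 \<or> v i = 1"
  shows "cube_segment k u v s \<in> cube_boundary k"
  unfolding cube_boundary_def
  using cube_segment_in_cube[OF assms(1-3)] assms(4-6)
  by (auto simp: cube_segment_def algebra_simps intro!: bexI[of _ i])

lemma origin_in_cube_boundary: "1 \<le> k \<Longrightarrow> (\<lambda>i\<in>{1..k}. 0) \<in> cube_boundary k"
  by (auto simp: cube_boundary_def topspace_cube intro!: bexI[of _ 1])

text \<open>A boundary point lies on a facet, which is convex and meets a coordinate facet in another
  direction, since there are at least two coordinates; so two segments inside the boundary lead to
  the origin.\<close>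

lemma connectedin_cube_boundary:
  assumes "2 \<le> k"
  shows "connectedin (cube k) (cube_boundary k)"
proof -
  let ?B = "subtopology (cube k) (cube_boundary k)"
  let ?o = "\<lambda>i\<in>{1..k}. 0 :: real"
  have o: "?o \<in> topspace (cube k)"
    by (simp add: topspace_cube)
  have seg: "path_component_of ?B u v"
    if u: "u \<in> topspace (cube k)" and v: "v \<in> topspace (cube k)"
      and i: "i \<in> {1..k}" "u i = v i" "v i = 0 \<or> v i = 1" for u v i
  proof -
    have "continuous_map (top_of_set {0..1}) (cube k) (cube_segment k u v)"
      using continuous_map_cube_segment[of "top_of_set {0..1}" k "\<lambda>_. u" "\<lambda>_. v" "\<lambda>s. s"] u v by simp
    then have "pathin ?B (cube_segment k u v)"
      using cube_segment_in_boundary[OF u v _ i]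
      by (simp add: pathin_def continuous_map_in_subtopology)
    then show ?thesis
      unfolding path_component_of_def using cube_segment_ends[OF u v] by blast
  qed
  have to_o: "path_component_of ?B t ?o" if t: "t \<in> cube_boundary k" for t
  proof -
    obtain i where i: "i \<in> {1..k}" "t i = 0 \<or> t i = 1"
      using t by (auto simp: cube_boundary_def)
    obtain j where j: "j \<in> {1..k}" "j \<noteq> i"
    proof
      show "(if i = 1 then 2 else 1) \<in> {1..k}" "(if i = 1 then 2 else 1) \<noteq> i"
        using assms by auto
    qed
    have t': "t \<in> topspace (cube k)"
      using t cube_boundary_subset by blast
    have tj: "t(j := 0) \<in> topspace (cube k)"
      using t' j(1) by (auto simp: topspace_cube PiE_def extensional_def Pi_def)
    have "path_component_of ?B t (t(j := 0))"
      by (rule seg[OF t' tj i(1)]) (use i j in auto)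
    moreover have "path_component_of ?B (t(j := 0)) ?o"
      by (rule seg[OF tj o j(1)]) (use j in auto)
    ultimately show ?thesis
      by (rule path_component_of_trans)
  qed
  have "path_connected_space ?B"
    unfolding path_connected_space_iff_path_component
    using to_o path_component_of_trans path_component_of_sym
    by (metis (no_types, lifting) Int_iff topspace_subtopology)
  then show ?thesis
    by (simp add: connectedin_def path_connected_imp_connected_space cube_boundary_subset)
qed

lemma bounded_cube_coordinate:
  "t \<in> topspace (cube k) \<Longrightarrow> i \<in> {1..k} \<Longrightarrow> 0 \<le> t i \<and> t i \<le> 1"
  by (auto simp: topspace_cube PiE_def Pi_def)

lemma cube_norm_le_iff:
  "1 \<le> k \<Longrightarrow> cube_norm k t \<le> c \<longleftrightarrow> (\<forall>i\<in>{1..k}. \<bar>2 * t i - 1\<bar> \<le> c)"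
  by (simp add: cube_norm_def)

lemma cube_norm_attained:
  assumes "1 \<le> k"
  obtains i where "i \<in> {1..k}" "cube_norm k t = \<bar>2 * t i - 1\<bar>"
proof -
  have "cube_norm k t \<in> (\<lambda>i. \<bar>2 * t i - 1\<bar>) ` {1..k}"
    unfolding cube_norm_def using assms by (intro Max_in) auto
  then show ?thesis
    using that by blast
qed

lemma cube_norm_cube:
  assumes "1 \<le> k" "t \<in> topspace (cube k)"
  shows "0 \<le> cube_norm k t" "cube_norm k t \<le> 1"
proof -
  show "0 \<le> cube_norm k t"
    using cube_norm_attained[OF assms(1), of t] by (metis abs_ge_zero)
  show "cube_norm k t \<le> 1"
    unfolding cube_norm_le_iff[OF assms(1)]
    using bounded_cube_coordinate[OF assms(2)] by (auto simp: abs_le_iff)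
qed

lemma cube_norm_boundary:
  assumes "t \<in> cube_boundary k"
  shows "cube_norm k t = 1"
proof -
  obtain i where i: "i \<in> {1..k}" "t i = 0 \<or> t i = 1"
    using assms by (auto simp: cube_boundary_def)
  have k: "1 \<le> k"
    using i by simp
  have "\<bar>2 * t i - 1\<bar> \<le> cube_norm k t"
    using cube_norm_le_iff[OF k, of t "cube_norm k t"] i(1) by simp
  moreover have "cube_norm k t \<le> 1"
    using cube_norm_cube[OF k] assms cube_boundary_subset by blast
  ultimately show ?thesis
    using i(2) by auto
qed

lemma continuous_map_cube_norm:
  assumes "1 \<le> k"
  shows "continuous_map (cube k) euclideanreal (cube_norm k)"
proof -
  have eq: "cube_norm k = (\<lambda>t. SUP i\<in>{1..k}. \<bar>2 * t i - 1\<bar>)"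
    using assms by (auto simp: cube_norm_def fun_eq_iff intro!: cSup_eq_Max[symmetric])
  show ?thesis
    unfolding eq by (intro continuous_intros continuous_map_cube_coordinate) auto
qed

section \<open>Homotopy classes of spheroids\<close>

abbreviation spheroid_homotopic ::
    "nat \<Rightarrow> 'a topology \<Rightarrow> 'a \<Rightarrow> ((nat \<Rightarrow> real) \<Rightarrow> 'a) \<Rightarrow> ((nat \<Rightarrow> real) \<Rightarrow> 'a) \<Rightarrow> bool" where
  "spheroid_homotopic k X x \<equiv> homotopic_with (\<lambda>h. h ` cube_boundary k \<subseteq> {x}) (cube k) X"

lemma spheroid_homotopicI:
  fixes H :: "real \<Rightarrow> (nat \<Rightarrow> real) \<Rightarrow> 'a"
  assumes "continuous_map (prod_topology (top_of_set {0..1}) (cube k)) X (\<lambda>(s, t). H s t)"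
    and "\<And>t. t \<in> topspace (cube k) \<Longrightarrow> H 0 t = f t"
    and "\<And>t. t \<in> topspace (cube k) \<Longrightarrow> H 1 t = g t"
    and "\<And>s t. s \<in> {0..1} \<Longrightarrow> t \<in> cube_boundary k \<Longrightarrow> H s t = x"
  shows "spheroid_homotopic k X x f g"
proof -
  have 0: "H 0 \<in> cube_boundary k \<rightarrow> {x}" and 1: "H 1 \<in> cube_boundary k \<rightarrow> {x}"
    using assms(4) by auto
  have "homotopic_with (\<lambda>h. h ` cube_boundary k \<subseteq> {x}) (cube k) X (H 0) (H 1)"
    unfolding homotopic_with_def
    using assms(1,4) by (intro exI[of _ "\<lambda>(s, t). H s t"]) auto
  then show ?thesis
    by (rule homotopic_with_eq) (use assms(2,3) 0 1 cube_boundary_subset in \<open>fastforce+\<close>)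
qed

lemma spheroid_homotopicE:
  assumes "spheroid_homotopic k X (x :: 'a) f g"
  obtains H :: "real \<Rightarrow> (nat \<Rightarrow> real) \<Rightarrow> 'a" where
    "continuous_map (prod_topology (top_of_set {0..1}) (cube k)) X (\<lambda>(s, t). H s t)"
    "H 0 = f" "H 1 = g" "\<And>s t. s \<in> {0..1} \<Longrightarrow> t \<in> cube_boundary k \<Longrightarrow> H s t = x"
proof -
  note witness = that
  have "thesis" if h: "continuous_map (prod_topology (top_of_set {0..1}) (cube k)) X h"
    "\<forall>t. h (0, t) = f t" "\<forall>t. h (1, t) = g t"
    "\<forall>s\<in>{0..1}. (\<lambda>t. h (s, t)) ` cube_boundary k \<subseteq> {x}"
    for h :: "real \<times> (nat \<Rightarrow> real) \<Rightarrow> 'a"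
    by (rule witness[of "curry h"]) (use h in \<open>auto simp: fun_eq_iff curry_def image_subset_iff\<close>)
  with assms show thesis
    unfolding homotopic_with_def by (elim exE conjE)
qed

lemma spheroid_homotopic_refl_iff: "spheroid_homotopic k X x f f \<longleftrightarrow> f \<in> spheroids k X x"
  by (simp add: spheroids_def)

lemma spheroid_homotopic_imp_spheroids:
  assumes "spheroid_homotopic k X x f g"
  shows "f \<in> spheroids k X x" "g \<in> spheroids k X x"
  using homotopic_with_imp_continuous_maps[OF assms] homotopic_with_imp_property[OF assms]
  by (auto simp: spheroids_def)

lemma pi_class_eqI: "spheroid_homotopic k X x f g \<Longrightarrow> pi_class k X x f = pi_class k X x g"
  unfolding pi_class_def set_eq_iff mem_Collect_eq by (meson homotopic_with_symD homotopic_with_trans)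

lemma pi_class_self: "f \<in> spheroids k X x \<Longrightarrow> f \<in> pi_class k X x f"
  by (simp add: pi_class_def spheroids_def)

lemma compose_spheroids:
  "continuous_map X Y \<phi> \<Longrightarrow> f \<in> spheroids k X x \<Longrightarrow> \<phi> \<circ> f \<in> spheroids k Y (\<phi> x)"
  using continuous_map_compose[of "cube k" X f Y \<phi>] by (auto simp: spheroids_def)

text \<open>A parameter space \<open>Z\<close> is carried along here and in \<open>continuous_map_shell\<close>: with \<open>Z\<close> an interval
  the statement says that the operation respects homotopies, which makes it well defined on classes.\<close>

lemma continuous_map_juxtapose:
  assumes k: "1 \<le> k"
    and F: "continuous_map (prod_topology Z (cube k)) X (\<lambda>(z, t). F z t)"
    and G: "continuous_map (prod_topology Z (cube k)) X (\<lambda>(z, t). G z t)"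
    and Fx: "\<And>z t. z \<in> topspace Z \<Longrightarrow> t \<in> cube_boundary k \<Longrightarrow> F z t = x"
    and Gx: "\<And>z t. z \<in> topspace Z \<Longrightarrow> t \<in> cube_boundary k \<Longrightarrow> G z t = x"
  shows "continuous_map (prod_topology Z (cube k)) X (\<lambda>(z, t). juxtapose (F z) (G z) t)"
proof -
  let ?W = "prod_topology Z (cube k)"
  let ?l = "\<lambda>t :: nat \<Rightarrow> real. t(1 := 2 * t 1)" and ?r = "\<lambda>t :: nat \<Rightarrow> real. t(1 := 2 * t 1 - 1)"
  have k1: "1 \<in> {1..k}"
    using k by simp
  have co: "continuous_map (subtopology ?W S) euclideanreal (\<lambda>w. snd w i)" if "i \<in> {1..k}" for S i
    by (rule continuous_map_compose_coordinate[OF continuous_map_subtopology_snd that])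
  have l: "?l t \<in> topspace (cube k)" if "t \<in> topspace (cube k)" "t 1 \<le> 1/2" for t
    using that bounded_cube_coordinate[OF that(1) k1] k1
    by (auto simp: topspace_cube PiE_def extensional_def Pi_def)
  have r: "?r t \<in> topspace (cube k)" if "t \<in> topspace (cube k)" "1/2 \<le> t 1" for t
    using that bounded_cube_coordinate[OF that(1) k1] k1
    by (auto simp: topspace_cube PiE_def extensional_def Pi_def)
  have "continuous_map (subtopology ?W {w \<in> topspace ?W. snd w 1 \<le> 1/2}) (cube k) (\<lambda>w. ?l (snd w))"
    unfolding continuous_map_into_cube
  proof (intro conjI ballI)
    show "continuous_map (subtopology ?W {w \<in> topspace ?W. snd w 1 \<le> 1/2}) euclideanreal
        (\<lambda>w. ?l (snd w) i)" if "i \<in> {1..k}" for i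
      by (cases "i = 1") (auto intro!: continuous_intros co simp: that k1 simp del: One_nat_def atLeastAtMost_iff)
  qed (use l in auto)
  then have "continuous_map (subtopology ?W {w \<in> topspace ?W. snd w 1 \<le> 1/2}) ?W
      (\<lambda>w. (fst w, ?l (snd w)))"
    by (intro continuous_intros)
  from continuous_map_compose[OF this F]
  have 1: "continuous_map (subtopology ?W {w \<in> topspace ?W. snd w 1 \<le> 1/2}) X
      (\<lambda>w. F (fst w) (?l (snd w)))"
    by (simp add: o_def)
  have "continuous_map (subtopology ?W {w \<in> topspace ?W. 1/2 \<le> snd w 1}) (cube k) (\<lambda>w. ?r (snd w))"
    unfolding continuous_map_into_cube
  proof (intro conjI ballI)
    show "continuous_map (subtopology ?W {w \<in> topspace ?W. 1/2 \<le> snd w 1}) euclideanreal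
        (\<lambda>w. ?r (snd w) i)" if "i \<in> {1..k}" for i
      by (cases "i = 1") (auto intro!: continuous_intros co simp: that k1 simp del: One_nat_def atLeastAtMost_iff)
  qed (use r in auto)
  then have "continuous_map (subtopology ?W {w \<in> topspace ?W. 1/2 \<le> snd w 1}) ?W
      (\<lambda>w. (fst w, ?r (snd w)))"
    by (intro continuous_intros)
  from continuous_map_compose[OF this G]
  have 2: "continuous_map (subtopology ?W {w \<in> topspace ?W. 1/2 \<le> snd w 1}) X
      (\<lambda>w. G (fst w) (?r (snd w)))"
    by (simp add: o_def)
  have "continuous_map ?W X
      (\<lambda>w. if snd w 1 \<le> 1/2 then F (fst w) (?l (snd w)) else G (fst w) (?r (snd w)))"
  proof (rule continuous_map_cases_le[OF _ _ 1 2])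
    show "continuous_map ?W euclideanreal (\<lambda>w. snd w 1)"
      by (rule continuous_map_compose_coordinate[OF continuous_map_snd k1])
    show "F (fst w) (?l (snd w)) = G (fst w) (?r (snd w))"
      if w: "w \<in> topspace ?W" "snd w 1 = 1/2" for w
    proof -
      have "?l (snd w) \<in> cube_boundary k" "?r (snd w) \<in> cube_boundary k"
        using l[of "snd w"] r[of "snd w"] w k1 by (auto simp: cube_boundary_def intro!: bexI[of _ 1])
      then show ?thesis
        using Fx Gx w by auto
    qed
  qed simp
  moreover have "(\<lambda>w. if snd w 1 \<le> 1/2 then F (fst w) (?l (snd w)) else G (fst w) (?r (snd w)))
      = (\<lambda>(z, t). juxtapose (F z) (G z) t)"
    by (auto simp: juxtapose_def fun_eq_iff)
  ultimately show ?thesis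
    by simp
qed

lemma juxtapose_boundary:
  assumes "f ` cube_boundary k \<subseteq> {x}" "g ` cube_boundary k \<subseteq> {x}" "t \<in> cube_boundary k"
  shows "juxtapose f g t = x"
proof -
  obtain i where i: "i \<in> {1..k}" "t i = 0 \<or> t i = 1" and t: "t \<in> topspace (cube k)"
    using assms(3) by (auto simp: cube_boundary_def)
  have k1: "1 \<in> {1..k}"
    using i by simp
  note b = bounded_cube_coordinate[OF t k1]
  have "t(1 := 2 * t 1) \<in> cube_boundary k" if "t 1 \<le> 1/2"
    unfolding cube_boundary_def using i t b k1 that
    by (auto simp: topspace_cube PiE_def extensional_def Pi_def intro!: bexI[of _ i])
  moreover have "t(1 := 2 * t 1 - 1) \<in> cube_boundary k" if "\<not> t 1 \<le> 1/2"
    unfolding cube_boundary_def using i t b k1 that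
    by (auto simp: topspace_cube PiE_def extensional_def Pi_def intro!: bexI[of _ i])
  ultimately show ?thesis
    using assms(1,2) by (auto simp: juxtapose_def)
qed

lemma spheroid_homotopic_juxtapose:
  assumes "1 \<le> k" "spheroid_homotopic k X x f f'" "spheroid_homotopic k X x g g'"
  shows "spheroid_homotopic k X x (juxtapose f g) (juxtapose f' g')"
proof -
  obtain F :: "real \<Rightarrow> _" where F: "continuous_map (prod_topology (top_of_set {0..1}) (cube k)) X (\<lambda>(s, t). F s t)"
    "F 0 = f" "F 1 = f'" "\<And>s t. s \<in> {0..1} \<Longrightarrow> t \<in> cube_boundary k \<Longrightarrow> F s t = x"
    using spheroid_homotopicE[OF assms(2)] by blast
  obtain G :: "real \<Rightarrow> _" where G: "continuous_map (prod_topology (top_of_set {0..1}) (cube k)) X (\<lambda>(s, t). G s t)"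
    "G 0 = g" "G 1 = g'" "\<And>s t. s \<in> {0..1} \<Longrightarrow> t \<in> cube_boundary k \<Longrightarrow> G s t = x"
    using spheroid_homotopicE[OF assms(3)] by blast
  show ?thesis
  proof (rule spheroid_homotopicI)
    show "continuous_map (prod_topology (top_of_set {0..1}) (cube k)) X
        (\<lambda>(s, t). juxtapose (F s) (G s) t)"
      by (rule continuous_map_juxtapose[where x = x]) (use assms(1) F G in auto)
    show "juxtapose (F s) (G s) t = x" if "s \<in> {0..1}" "t \<in> cube_boundary k" for s t
      by (rule juxtapose_boundary[OF _ _ that(2)]) (use that F G in auto)
  qed (simp_all add: F G)
qed

lemma mult_pi_class:
  assumes "1 \<le> k" "f \<in> spheroids k X x" "g \<in> spheroids k X x"
  shows "pi_class k X x f \<otimes>\<^bsub>pi_group k X x\<^esub> pi_class k X x g = pi_class k X x (juxtapose f g)"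
proof -
  let ?c = "pi_class k X x"
  have eq: "?c (juxtapose f' g') = ?c (juxtapose f g)"
    if "f' \<in> pi_class k X x f" "g' \<in> pi_class k X x g" for f' g'
  proof -
    have "spheroid_homotopic k X x f f'" "spheroid_homotopic k X x g g'"
      using that by (auto simp: pi_class_def)
    then show ?thesis
      by (intro pi_class_eqI[symmetric] spheroid_homotopic_juxtapose assms(1))
  qed
  have "(\<Union>f'\<in>?c f. \<Union>g'\<in>?c g. ?c (juxtapose f' g')) = (\<Union>f'\<in>?c f. \<Union>g'\<in>?c g. ?c (juxtapose f g))"
    by (intro SUP_cong refl eq)
  also have "\<dots> = ?c (juxtapose f g)"
    using pi_class_self[OF assms(2)] pi_class_self[OF assms(3)] by auto
  finally show ?thesis
    by (simp add: pi_group_def)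
qed

lemma juxtapose_spheroids:
  assumes "1 \<le> k" "f \<in> spheroids k X x" "g \<in> spheroids k X x"
  shows "juxtapose f g \<in> spheroids k X x"
  using spheroid_homotopic_juxtapose[OF assms(1)] assms(2,3)
  by (metis spheroid_homotopic_refl_iff)

lemma carrier_pi_group: "carrier (pi_group k X x) = pi_class k X x ` spheroids k X x"
  by (simp add: pi_group_def)

text \<open>Composition with a map commutes with juxtaposition already on the level of spheroids.\<close>

proposition pi_map_hom:
  assumes k: "1 \<le> k" and \<phi>: "continuous_map X Y \<phi>"
  shows "pi_map k Y \<phi> x \<in> hom (pi_group k X x) (pi_group k Y (\<phi> x))"
proof (rule homI)
  show "pi_map k Y \<phi> x A \<in> carrier (pi_group k Y (\<phi> x))" if "A \<in> carrier (pi_group k X x)" for A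
    using that pi_map_pi_class[OF \<phi>] compose_spheroids[OF \<phi>] by (auto simp: carrier_pi_group)
  show "pi_map k Y \<phi> x (A \<otimes>\<^bsub>pi_group k X x\<^esub> B)
      = pi_map k Y \<phi> x A \<otimes>\<^bsub>pi_group k Y (\<phi> x)\<^esub> pi_map k Y \<phi> x B"
    if AB: "A \<in> carrier (pi_group k X x)" "B \<in> carrier (pi_group k X x)" for A B
  proof -
    obtain f g where f: "f \<in> spheroids k X x" "A = pi_class k X x f"
      and g: "g \<in> spheroids k X x" "B = pi_class k X x g"
      using AB by (auto simp: carrier_pi_group)
    have "\<phi> \<circ> juxtapose f g = juxtapose (\<phi> \<circ> f) (\<phi> \<circ> g)"
      by (auto simp: juxtapose_def fun_eq_iff)
    then show ?thesis
      using f g by (simp add: mult_pi_class[OF k] juxtapose_spheroids[OF k] pi_map_pi_class[OF \<phi>] compose_spheroids[OF \<phi>])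
  qed
qed

section \<open>Change of basepoint\<close>

lemma cube_norm_le_half:
  assumes "1 \<le> k" "cube_norm k t \<le> 1/2" "i \<in> {1..k}"
  shows "1/4 \<le> t i" "t i \<le> 3/4"
proof -
  have "\<bar>2 * t i - 1\<bar> \<le> 1/2"
    using assms cube_norm_le_iff by blast
  then show "1/4 \<le> t i" "t i \<le> 3/4"
    by linarith+
qed

lemma inner_cube_stretch:
  assumes "1 \<le> k" "cube_norm k t \<le> 1/2"
  shows "(\<lambda>i\<in>{1..k}. 2 * t i - 1/2) \<in> topspace (cube k)"
proof -
  have "2 * t i - 1/2 \<in> {0..1}" if "i \<in> {1..k}" for i
    using cube_norm_le_half[OF assms that] by simp
  then show ?thesis
    by (simp add: topspace_cube restrict_PiE_iff del: One_nat_def atLeastAtMost_iff)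
qed

lemma continuous_map_shell:
  assumes k: "1 \<le> k"
    and H: "continuous_map (prod_topology Z (cube k)) X (\<lambda>(z, t). H z t)"
    and \<Gamma>: "continuous_map (prod_topology Z (top_of_set {0..1})) X (\<lambda>(z, r). \<Gamma> z r)"
    and match: "\<And>z t. z \<in> topspace Z \<Longrightarrow> t \<in> cube_boundary k \<Longrightarrow> H z t = \<Gamma> z 0"
  shows "continuous_map (prod_topology Z (cube k)) X (\<lambda>(z, t). shell k (\<Gamma> z) (H z) t)"
proof -
  let ?W = "prod_topology Z (cube k)"
  let ?in = "\<lambda>t :: nat \<Rightarrow> real. \<lambda>i\<in>{1..k}. 2 * t i - 1/2"
  let ?V = "{w \<in> topspace ?W. cube_norm k (snd w) \<le> 1/2}"
  let ?V' = "{w \<in> topspace ?W. 1/2 \<le> cube_norm k (snd w)}"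
  have inner: "?in t \<in> topspace (cube k)" if "cube_norm k t \<le> 1/2" for t
    using inner_cube_stretch[OF k that] .
  have cn: "continuous_map (subtopology ?W S) euclideanreal (\<lambda>w. cube_norm k (snd w))" for S
    using continuous_map_compose[OF continuous_map_subtopology_snd continuous_map_cube_norm[OF k]]
    by (simp add: o_def)
  have "continuous_map (subtopology ?W ?V) (cube k) (\<lambda>w. ?in (snd w))"
    unfolding continuous_map_into_cube
  proof (intro conjI ballI)
    show "continuous_map (subtopology ?W ?V) euclideanreal (\<lambda>w. ?in (snd w) i)"
      if "i \<in> {1..k}" for i
      unfolding restrict_apply'[OF that]
      by (intro continuous_intros continuous_map_compose_coordinate[OF continuous_map_subtopology_snd that])
  qed (use inner in auto)
  then have "continuous_map (subtopology ?W ?V) ?W (\<lambda>w. (fst w, ?in (snd w)))"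
    by (intro continuous_intros)
  from continuous_map_compose[OF this H]
  have 1: "continuous_map (subtopology ?W ?V) X (\<lambda>w. H (fst w) (?in (snd w)))"
    by (simp add: o_def)
  have "continuous_map (subtopology ?W ?V') (top_of_set {0..1}) (\<lambda>w. 2 * cube_norm k (snd w) - 1)"
    using cube_norm_cube[OF k]
    by (auto simp: continuous_map_in_subtopology intro!: continuous_intros cn)
  then have "continuous_map (subtopology ?W ?V') (prod_topology Z (top_of_set {0..1}))
      (\<lambda>w. (fst w, 2 * cube_norm k (snd w) - 1))"
    by (intro continuous_intros)
  from continuous_map_compose[OF this \<Gamma>]
  have 2: "continuous_map (subtopology ?W ?V') X (\<lambda>w. \<Gamma> (fst w) (2 * cube_norm k (snd w) - 1))"
    by (simp add: o_def)
  have "continuous_map ?W X (\<lambda>w. if cube_norm k (snd w) \<le> 1/2 then H (fst w) (?in (snd w))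
      else \<Gamma> (fst w) (2 * cube_norm k (snd w) - 1))"
  proof (rule continuous_map_cases_le[OF _ _ 1 2])
    show "continuous_map ?W euclideanreal (\<lambda>w. cube_norm k (snd w))"
      using continuous_map_compose[OF continuous_map_snd continuous_map_cube_norm[OF k]]
      by (simp add: o_def)
    show "H (fst w) (?in (snd w)) = \<Gamma> (fst w) (2 * cube_norm k (snd w) - 1)"
      if w: "w \<in> topspace ?W" "cube_norm k (snd w) = 1/2" for w
    proof -
      obtain i where i: "i \<in> {1..k}" "1/2 = \<bar>2 * snd w i - 1\<bar>"
        using cube_norm_attained[OF k, of "snd w"] w(2) by metis
      then have "?in (snd w) i = 0 \<or> ?in (snd w) i = 1"
        unfolding restrict_apply'[OF i(1)] by (auto simp: abs_if split: if_splits)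
      then have "?in (snd w) \<in> cube_boundary k"
        by (rule cube_boundaryI[OF inner[OF eq_refl[OF w(2)]] i(1)])
      then have "H (fst w) (?in (snd w)) = \<Gamma> (fst w) 0"
        using match w(1) by auto
      moreover have "2 * cube_norm k (snd w) - 1 = 0"
        using w(2) by linarith
      ultimately show ?thesis
        by (simp only:)
    qed
  qed simp
  moreover have "(\<lambda>w. if cube_norm k (snd w) \<le> 1/2 then H (fst w) (?in (snd w))
      else \<Gamma> (fst w) (2 * cube_norm k (snd w) - 1)) = (\<lambda>(z, t). shell k (\<Gamma> z) (H z) t)"
    by (auto simp: shell_def fun_eq_iff)
  ultimately show ?thesis
    by simp
qed

lemma shell_boundary: "t \<in> cube_boundary k \<Longrightarrow> shell k \<gamma> f t = \<gamma> 1"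
  by (simp add: shell_def cube_norm_boundary)

lemma shell_cong:
  assumes "1 \<le> k" "t \<in> topspace (cube k)"
    and "\<And>t. t \<in> topspace (cube k) \<Longrightarrow> f t = f' t" "\<And>r. r \<in> {0..1} \<Longrightarrow> \<gamma> r = \<gamma>' r"
  shows "shell k \<gamma> f t = shell k \<gamma>' f' t"
proof (cases "cube_norm k t \<le> 1/2")
  case True
  then have "(\<lambda>i\<in>{1..k}. 2 * t i - 1/2) \<in> topspace (cube k)"
    by (rule inner_cube_stretch[OF assms(1)])
  then show ?thesis
    using True assms(3) by (simp add: shell_def)
next
  case False
  then have "2 * cube_norm k t - 1 \<in> {0..1}"
    using cube_norm_cube[OF assms(1,2)] by auto
  then show ?thesis
    using False assms(4) by (simp add: shell_def)
qed

text \<open>The path and the spheroid may move at the same time, the path with fixed end points. So the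
  change of basepoint depends only on the class of the spheroid and on the homotopy class of the
  path.\<close>

lemma spheroid_homotopic_shell:
  fixes \<Gamma> :: "real \<Rightarrow> real \<Rightarrow> 'a"
  assumes "1 \<le> k" and f: "spheroid_homotopic k X x f f'"
    and \<Gamma>: "continuous_map (prod_topology (top_of_set {0..1}) (top_of_set {0..1})) X (\<lambda>(s, r). \<Gamma> s r)"
    and ends: "\<And>s. s \<in> {0..1} \<Longrightarrow> \<Gamma> s 0 = x" "\<And>s. s \<in> {0..1} \<Longrightarrow> \<Gamma> s 1 = y"
  shows "spheroid_homotopic k X y (shell k (\<Gamma> 0) f) (shell k (\<Gamma> 1) f')"
proof -
  obtain F :: "real \<Rightarrow> _" where F:
    "continuous_map (prod_topology (top_of_set {0..1}) (cube k)) X (\<lambda>(s, t). F s t)"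
    "F 0 = f" "F 1 = f'" "\<And>s t. s \<in> {0..1} \<Longrightarrow> t \<in> cube_boundary k \<Longrightarrow> F s t = x"
    using spheroid_homotopicE[OF f] by blast
  show ?thesis
  proof (rule spheroid_homotopicI)
    show "continuous_map (prod_topology (top_of_set {0..1}) (cube k)) X
        (\<lambda>(s, t). shell k (\<Gamma> s) (F s) t)"
      by (rule continuous_map_shell) (use assms F in auto)
  qed (use F ends in \<open>auto simp: shell_boundary\<close>)
qed

lemma change_basepoint_pi_class:
  assumes k: "1 \<le> k" and f: "f \<in> spheroids k X (\<gamma> 0)" and \<gamma>: "pathin X \<gamma>"
  shows "change_basepoint k X \<gamma> (pi_class k X (\<gamma> 0) f) = pi_class k X (\<gamma> 1) (shell k \<gamma> f)"
proof -
  have "continuous_map (prod_topology (top_of_set {0..1::real}) (top_of_set {0..1})) X (\<gamma> \<circ> snd)"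
    using \<gamma> unfolding pathin_def by (rule continuous_map_compose[OF continuous_map_snd])
  then have \<Gamma>: "continuous_map (prod_topology (top_of_set {0..1::real}) (top_of_set {0..1})) X
      (\<lambda>(s, r). \<gamma> r)"
    by (simp only: o_def case_prod_beta')
  have eq: "pi_class k X (\<gamma> 1) (shell k \<gamma> h) = pi_class k X (\<gamma> 1) (shell k \<gamma> f)"
    if "h \<in> pi_class k X (\<gamma> 0) f" for h
  proof -
    have "spheroid_homotopic k X (\<gamma> 0) f h"
      using that by (simp add: pi_class_def)
    from spheroid_homotopic_shell[OF k this \<Gamma> refl refl] show ?thesis
      by (rule pi_class_eqI[symmetric])
  qed
  have "change_basepoint k X \<gamma> (pi_class k X (\<gamma> 0) f)
      = (\<Union>h\<in>pi_class k X (\<gamma> 0) f. pi_class k X (\<gamma> 1) (shell k \<gamma> f))"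
    unfolding change_basepoint_def by (intro SUP_cong refl eq)
  also have "\<dots> = pi_class k X (\<gamma> 1) (shell k \<gamma> f)"
    using pi_class_self[OF f] by auto
  finally show ?thesis .
qed

text \<open>Along a constant path the change of basepoint precomposes with the map that stretches the
  half-size cube and clamps every coordinate to the unit interval. The segment from each \<open>t\<close> to its
  clamped image stays in the facets that contain \<open>t\<close>, so this map is homotopic to the identity
  through maps that preserve the boundary.\<close>

lemma shell_constant_path:
  assumes k: "1 \<le> k" and f: "f \<in> spheroids k X x"
  shows "spheroid_homotopic k X x (shell k (\<lambda>_. x) f) f"
proof -
  let ?c = "\<lambda>t :: nat \<Rightarrow> real. \<lambda>i\<in>{1..k}. max 0 (min 1 (2 * t i - 1/2))"
  have fb: "f t = x" if "t \<in> cube_boundary k" for t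
    using f that by (auto simp: spheroids_def)
  have fc: "continuous_map (cube k) X f"
    using f by (simp add: spheroids_def)
  have c: "?c t \<in> topspace (cube k)" for t
    by (auto simp: topspace_cube)
  have cc: "continuous_map (cube k) (cube k) ?c"
    unfolding continuous_map_into_cube
  proof (intro conjI ballI)
    show "continuous_map (cube k) euclideanreal (\<lambda>t. ?c t i)" if "i \<in> {1..k}" for i
      unfolding restrict_apply'[OF that]
      by (intro continuous_intros continuous_map_cube_coordinate that)
  qed (use c in auto)
  have shell_eq: "shell k (\<lambda>_. x) f t = f (?c t)" for t
  proof (cases "cube_norm k t \<le> 1/2")
    case True
    then have "?c t = (\<lambda>i\<in>{1..k}. 2 * t i - 1/2)"
      using cube_norm_le_half[OF k True] by (intro restrict_ext) force
    then show ?thesis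
      using True by (simp add: shell_def)
  next
    case False
    obtain i where i: "i \<in> {1..k}" "cube_norm k t = \<bar>2 * t i - 1\<bar>"
      using cube_norm_attained[OF k] by metis
    have "?c t i = 0 \<or> ?c t i = 1"
      unfolding restrict_apply'[OF i(1)] using i(2) False by (auto simp: abs_if split: if_splits)
    then have "?c t \<in> cube_boundary k"
      by (rule cube_boundaryI[OF c i(1)])
    then show ?thesis
      using False by (simp add: shell_def fb)
  qed
  let ?H = "\<lambda>s t. f (cube_segment k (?c t) t s)"
  show ?thesis
  proof (rule spheroid_homotopicI[of k X ?H])
    let ?W = "prod_topology (top_of_set {0..1::real}) (cube k)"
    have "continuous_map ?W (cube k) (\<lambda>w. cube_segment k (?c (snd w)) (snd w) (fst w))"
      using continuous_map_compose[OF continuous_map_snd cc]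
      by (intro continuous_map_cube_segment continuous_map_fst continuous_map_snd) (simp add: o_def)
    from continuous_map_compose[OF this fc] show "continuous_map ?W X (\<lambda>(s, t). ?H s t)"
      by (simp add: o_def case_prod_beta')
    show "?H 0 t = shell k (\<lambda>_. x) f t" "?H 1 t = f t" if "t \<in> topspace (cube k)" for t
      using cube_segment_ends[OF c that] by (simp_all add: shell_eq)
    show "?H s t = x" if s: "s \<in> {0..1}" and t: "t \<in> cube_boundary k" for s t
    proof -
      obtain i where i: "i \<in> {1..k}" "t i = 0 \<or> t i = 1" and tc: "t \<in> topspace (cube k)"
        using t by (auto simp: cube_boundary_def)
      have "?c t i = t i"
        unfolding restrict_apply'[OF i(1)] using i(2) by auto
      then show ?thesis
        using cube_segment_in_boundary[OF c tc s i(1) _ i(2)] fb by blast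
    qed
  qed
qed

section \<open>Maps to a sphere that are nowhere antipodal\<close>

text \<open>Radial projection of the straight segment from \<open>a\<close> to \<open>b\<close>. For unit vectors that are not
  antipodal this is the shorter great circle arc; for antipodal ones the segment meets the origin,
  where \<open>sgn\<close> vanishes.\<close>

definition great_arc :: "'a::real_normed_vector \<Rightarrow> 'a \<Rightarrow> real \<Rightarrow> 'a" where
  "great_arc a b s = sgn ((1 - s) *\<^sub>R a + s *\<^sub>R b)"

lemma great_arc_ends: "norm a = 1 \<Longrightarrow> great_arc a b 0 = a" "norm b = 1 \<Longrightarrow> great_arc a b 1 = b"
  by (simp_all add: great_arc_def sgn_div_norm)

lemma great_arc_const: "norm a = 1 \<Longrightarrow> great_arc a a s = a"
  by (simp add: great_arc_def sgn_div_norm flip: scaleR_left_distrib)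

text \<open>If a point of the segment were \<open>- c b\<close>, then \<open>(1 - s) a = - (c + s) b\<close>; both sides have the same
  norm, so \<open>1 - s = c + s\<close>, and \<open>a = - b\<close> unless both numbers vanish, which they cannot. The case
  \<open>c = 0\<close> makes the great arc well defined; positive \<open>c\<close> show that it does not reach \<open>- b\<close>.\<close>

lemma segment_avoids_opposite_ray:
  fixes a b :: "'a::real_normed_vector"
  assumes "norm a = 1" "norm b = 1" "a \<noteq> - b" "s \<in> {0..1}" "0 \<le> c"
  shows "(1 - s) *\<^sub>R a + s *\<^sub>R b \<noteq> - (c *\<^sub>R b)"
proof
  assume eq: "(1 - s) *\<^sub>R a + s *\<^sub>R b = - (c *\<^sub>R b)"
  then have *: "(1 - s) *\<^sub>R a = - ((c + s) *\<^sub>R b)"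
    by (simp add: algebra_simps eq_neg_iff_add_eq_0)
  then have "norm ((1 - s) *\<^sub>R a) = norm ((c + s) *\<^sub>R b)"
    by simp
  then have "1 - s = c + s"
    using assms by simp
  then have "(1 - s) *\<^sub>R (a + b) = 0"
    using * by (simp add: scaleR_right_distrib)
  then have "s = 1"
    using assms(3) by (auto simp: eq_neg_iff_add_eq_0)
  then show False
    using \<open>1 - s = c + s\<close> assms(5) by simp
qed

lemma great_arc_denominator:
  fixes a b :: "'a::real_normed_vector"
  assumes "norm a = 1" "norm b = 1" "a \<noteq> - b" "s \<in> {0..1}"
  shows "(1 - s) *\<^sub>R a + s *\<^sub>R b \<noteq> 0"
  using segment_avoids_opposite_ray[OF assms, of 0] by simp

lemma great_arc_not_opposite:
  fixes a b :: "'a::real_normed_vector"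
  assumes "norm a = 1" "norm b = 1" "a \<noteq> - b" "s \<in> {0..1}"
  shows "great_arc a b s \<noteq> - b"
proof
  let ?w = "(1 - s) *\<^sub>R a + s *\<^sub>R b"
  assume "great_arc a b s = - b"
  then have "norm ?w *\<^sub>R sgn ?w = norm ?w *\<^sub>R - b"
    by (simp add: great_arc_def)
  then have "?w = - (norm ?w *\<^sub>R b)"
    using great_arc_denominator[OF assms] by (simp add: sgn_div_norm)
  then show False
    using segment_avoids_opposite_ray[OF assms, of "norm ?w"] by simp
qed

lemma continuous_map_great_arc:
  fixes u v :: "'b \<Rightarrow> 'a::real_normed_vector"
  assumes u: "continuous_map Z (top_of_set (sphere 0 1)) u"
    and v: "continuous_map Z (top_of_set (sphere 0 1)) v"
    and s: "continuous_map Z (top_of_set {0..1}) s"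
    and uv: "\<And>z. z \<in> topspace Z \<Longrightarrow> u z \<noteq> - v z"
  shows "continuous_map Z (top_of_set (sphere 0 1)) (\<lambda>z. great_arc (u z) (v z) (s z))"
proof -
  have n: "norm (u z) = 1" "norm (v z) = 1" "s z \<in> {0..1}" if "z \<in> topspace Z" for z
    using u v s that by (auto simp: continuous_map_in_subtopology)
  have nz: "(1 - s z) *\<^sub>R u z + s z *\<^sub>R v z \<noteq> 0" if "z \<in> topspace Z" for z
    using great_arc_denominator[OF n(1,2)[OF that] uv[OF that] n(3)[OF that]] .
  have "continuous_map Z euclidean u" "continuous_map Z euclidean v" "continuous_map Z euclideanreal s"
    using u v s by (auto simp: continuous_map_in_subtopology)
  then have "continuous_map Z euclidean (\<lambda>z. (1 - s z) *\<^sub>R u z + s z *\<^sub>R v z)"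
    by (simp add: continuous_map_atin tendsto_intros)
  then have "continuous_map Z (top_of_set (- {0})) (\<lambda>z. (1 - s z) *\<^sub>R u z + s z *\<^sub>R v z)"
    using nz by (simp add: continuous_map_in_subtopology)
  moreover have "continuous_map (top_of_set (- {0 :: 'a})) (top_of_set (sphere 0 1)) sgn"
    by (auto intro!: continuous_intros simp: norm_sgn)
  ultimately show ?thesis
    unfolding great_arc_def using continuous_map_compose[of Z _ _ _ sgn] by (fastforce simp: o_def)
qed

lemma nowhere_antipodal_spheroid_homotopic:
  fixes f g :: "(nat \<Rightarrow> real) \<Rightarrow> 'a::real_normed_vector"
  assumes f: "f \<in> spheroids k (top_of_set (sphere 0 1)) b"
    and g: "g \<in> spheroids k (top_of_set (sphere 0 1)) b"
    and fg: "\<And>t. t \<in> topspace (cube k) \<Longrightarrow> f t \<noteq> - g t"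
  shows "spheroid_homotopic k (top_of_set (sphere 0 1)) b f g"
proof -
  let ?W = "prod_topology (top_of_set {0..1::real}) (cube k)"
  have fc: "continuous_map (cube k) (top_of_set (sphere 0 1)) f"
    and gc: "continuous_map (cube k) (top_of_set (sphere 0 1)) g"
    using f g by (auto simp: spheroids_def)
  then have n: "norm (f t) = 1" "norm (g t) = 1" if "t \<in> topspace (cube k)" for t
    using that by (auto simp: continuous_map_in_subtopology)
  show ?thesis
  proof (rule spheroid_homotopicI[of k _ "\<lambda>s t. great_arc (f t) (g t) s"])
    have "continuous_map ?W (top_of_set (sphere 0 1)) (\<lambda>w. great_arc (f (snd w)) (g (snd w)) (fst w))"
      using continuous_map_compose[OF continuous_map_snd fc] continuous_map_compose[OF continuous_map_snd gc] fg
      by (intro continuous_map_great_arc continuous_map_fst) (auto simp: o_def)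
    then show "continuous_map ?W (top_of_set (sphere 0 1)) (\<lambda>(s, t). great_arc (f t) (g t) s)"
      by (simp add: case_prod_beta')
    show "great_arc (f t) (g t) s = b" if "s \<in> {0..1}" and t: "t \<in> cube_boundary k" for s t
    proof -
      have "f t = b" "g t = b"
        using f g t by (auto simp: spheroids_def)
      then show ?thesis
        using n(1)[of t] t cube_boundary_subset[of k] by (auto simp: great_arc_const)
    qed
  qed (simp_all add: great_arc_ends n)
qed

text \<open>The sphere is simply connected, so \<open>\<gamma>\<close> may be replaced by the great arc from \<open>a\<close> to \<open>b\<close>. Then
  the shell of \<open>f\<close> along the arc and the shell of \<open>g\<close> along the constant path at \<open>b\<close> are nowhere
  antipodal: on the inner cube by hypothesis, and on the outer part because the arc avoids \<open>- b\<close>.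
  Moving along great arcs deforms one into the other.\<close>

proposition shell_homotopic_nowhere_antipodal:
  fixes f g :: "(nat \<Rightarrow> real) \<Rightarrow> 'a::euclidean_space"
  defines "S \<equiv> sphere (0::'a) 1"
  assumes dim: "3 \<le> DIM('a)" and k: "1 \<le> k"
    and f: "f \<in> spheroids k (top_of_set S) a" and g: "g \<in> spheroids k (top_of_set S) b"
    and fg: "\<And>t. t \<in> topspace (cube k) \<Longrightarrow> f t \<noteq> - g t"
    and \<gamma>: "path \<gamma>" "path_image \<gamma> \<subseteq> S" "pathstart \<gamma> = a" "pathfinish \<gamma> = b"
  shows "spheroid_homotopic k (top_of_set S) b (shell k \<gamma> f) g"
proof -
  have fS: "continuous_map (cube k) (top_of_set S) f" and gS: "continuous_map (cube k) (top_of_set S) g"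
    using f g by (auto simp: spheroids_def)
  have "a \<in> S" "b \<in> S"
    using \<gamma> pathstart_in_path_image pathfinish_in_path_image by blast+
  then have n: "norm a = 1" "norm b = 1"
    by (auto simp: S_def)
  have ab: "a \<noteq> - b"
  proof -
    let ?o = "\<lambda>i\<in>{1..k}. 0 :: real"
    have "?o \<in> cube_boundary k" "?o \<in> topspace (cube k)"
      using origin_in_cube_boundary[OF k] cube_boundary_subset by blast+
    moreover from this have "f ?o = a" "g ?o = b"
      using f g by (auto simp: spheroids_def)
    ultimately show ?thesis
      using fg by metis
  qed
  have arc: "continuous_map (top_of_set {0..1}) (top_of_set S) (great_arc a b)"
    using continuous_map_great_arc[of "top_of_set {0..1}" "\<lambda>_. a" "\<lambda>_. b" "\<lambda>s. s"] n ab
    by (simp add: S_def)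
  have "path (great_arc a b)" "path_image (great_arc a b) \<subseteq> S"
    using arc by (auto simp: path_def path_image_def continuous_map_in_subtopology)
  moreover have "pathstart (great_arc a b) = a" "pathfinish (great_arc a b) = b"
    by (simp_all add: pathstart_def pathfinish_def great_arc_ends n)
  ultimately have "homotopic_paths S \<gamma> (great_arc a b)"
    using simply_connected_sphere[OF dim, of 0 1] \<gamma>
    unfolding S_def simply_connected_eq_homotopic_paths by simp
  then obtain h where h: "continuous_on ({0..1} \<times> {0..1}) h" "h \<in> ({0..1} \<times> {0..1}) \<rightarrow> S"
    "\<And>r. r \<in> {0..1} \<Longrightarrow> h (0, r) = \<gamma> r" "\<And>r. r \<in> {0..1} \<Longrightarrow> h (1, r) = great_arc a b r"
    "\<And>s. s \<in> {0..1::real} \<Longrightarrow> h (s, 0) = a" "\<And>s. s \<in> {0..1} \<Longrightarrow> h (s, 1) = b"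
    using \<gamma> unfolding homotopic_paths by (auto simp: pathstart_def pathfinish_def)
  have "spheroid_homotopic k (top_of_set S) b (shell k (curry h 0) f) (shell k (curry h 1) f)"
    by (rule spheroid_homotopic_shell[where x = a, OF k spheroid_homotopic_refl_iff[THEN iffD2, OF f]])
      (use h in auto)
  then have 1: "spheroid_homotopic k (top_of_set S) b (shell k \<gamma> f) (shell k (great_arc a b) f)"
  proof (rule homotopic_with_eq)
    show "shell k \<gamma> f t = shell k (curry h 0) f t"
      "shell k (great_arc a b) f t = shell k (curry h 1) f t" if "t \<in> topspace (cube k)" for t
      using h(3,4) by (auto intro!: shell_cong[OF k that])
    show "u ` cube_boundary k \<subseteq> {b} \<longleftrightarrow> v ` cube_boundary k \<subseteq> {b}"
      if "\<And>t. t \<in> topspace (cube k) \<Longrightarrow> u t = v t" for u v :: "(nat \<Rightarrow> real) \<Rightarrow> 'a"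
      using that cube_boundary_subset by (metis (no_types, lifting) image_cong subsetD)
  qed
  have 2: "spheroid_homotopic k (top_of_set S) b (shell k (\<lambda>_. b) g) g"
    by (rule shell_constant_path[OF k g])
  have "spheroid_homotopic k (top_of_set S) b (shell k (great_arc a b) f) (shell k (\<lambda>_. b) g)"
    unfolding S_def
  proof (rule nowhere_antipodal_spheroid_homotopic)
    show "shell k (great_arc a b) f \<in> spheroids k (top_of_set (sphere 0 1)) b"
      "shell k (\<lambda>_. b) g \<in> spheroids k (top_of_set (sphere 0 1)) b"
      using spheroid_homotopic_imp_spheroids[OF 1] spheroid_homotopic_imp_spheroids[OF 2]
      by (auto simp: S_def)
    show "shell k (great_arc a b) f t \<noteq> - shell k (\<lambda>_. b) g t" if t: "t \<in> topspace (cube k)" for t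
    proof (cases "cube_norm k t \<le> 1/2")
      case True
      then show ?thesis
        using fg[OF inner_cube_stretch[OF k True]] by (simp add: shell_def)
    next
      case False
      then show ?thesis
        using great_arc_not_opposite[OF n ab, of "2 * cube_norm k t - 1"] cube_norm_cube[OF k t]
        by (simp add: shell_def)
    qed
  qed
  with 1 2 show ?thesis
    by (meson homotopic_with_trans)
qed

section \<open>The antipodal double cover\<close>

text \<open>The symmetric matrix \<open>v v\<^sup>T\<close>, the quadratic Veronese embedding of projective space.\<close>

definition veronese :: "real^'n \<Rightarrow> real^'n^'n" where
  "veronese v = (\<chi> i j. v $ i * v $ j)"

lemma veronese_mult_vec: "veronese v *v u = (u \<bullet> v) *\<^sub>R v"
  by (simp add: veronese_def matrix_vector_mult_def vec_eq_iff inner_vec_def sum_distrib_left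
      mult_ac)

lemma continuous_on_veronese: "continuous_on A veronese"
  unfolding veronese_def by (intro continuous_intros)

lemma veronese_eq_iff:
  fixes v w :: "real^'n"
  assumes "norm v = 1" "norm w = 1"
  shows "veronese v = veronese w \<longleftrightarrow> v = w \<or> v = - w"
proof
  assume eq: "veronese v = veronese w"
  have "v = (v \<bullet> v) *\<^sub>R v"
    using assms(1) by (simp add: dot_square_norm)
  also have "\<dots> = (v \<bullet> w) *\<^sub>R w"
    using eq by (metis veronese_mult_vec)
  finally have v: "v = (v \<bullet> w) *\<^sub>R w" .
  then have "\<bar>v \<bullet> w\<bar> = 1"
    using assms by (metis mult.right_neutral norm_scaleR)
  then show "v = w \<or> v = - w"
    using v by (metis abs_if add.inverse_inverse scaleR_minus1_left scaleR_one)
qed (auto simp: veronese_def vec_eq_iff)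

text \<open>Around the image of \<open>u\<close> the evenly covered set is given by \<open>(u \<bullet> v)\<^sup>2 > 0\<close>; its sheets are the two
  open hemispheres with poles \<open>u\<close> and \<open>- u\<close>. Since \<open>v v\<^sup>T u = (u \<bullet> v) v\<close>, normalizing the image of \<open>u\<close>
  under the matrix recovers \<open>v\<close> up to the sign that names the sheet.\<close>

lemma covering_space_veronese:
  "covering_space (sphere 0 1) veronese (veronese ` sphere (0 :: real^'n) 1)"
proof
  let ?S = "sphere (0 :: real^'n) 1"
  let ?P = "veronese ` ?S"
  show "continuous_on ?S veronese"
    by (rule continuous_on_veronese)
  fix M assume "M \<in> ?P"
  then obtain u where u: "norm u = 1" "M = veronese u"
    by auto
  \<comment> \<open>The value of the quadratic form at \<open>u\<close>, which separates the hemispheres from their common equator.\<close>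
  define q where "q N = u \<bullet> (N *v u)" for N :: "real^'n^'n"
  let ?T = "?P \<inter> q -` {0<..}"
  let ?V = "\<lambda>e. {v \<in> ?S. 0 < e * (u \<bullet> v)}"
  have q_veronese: "q (veronese v) = (u \<bullet> v)\<^sup>2" for v
    by (simp add: q_def veronese_mult_vec power2_eq_square inner_commute)
  have cont: "continuous_on A (\<lambda>N :: real^'n^'n. N *v u)" for A
    unfolding matrix_vector_mult_def by (intro continuous_intros)
  have 1: "M \<in> ?T"
    using u by (simp add: q_veronese dot_square_norm)
  have 2: "openin (top_of_set ?P) ?T"
    unfolding q_def by (intro continuous_openin_preimage_gen continuous_intros cont open_greaterThan)
  have T_iff: "veronese v \<in> ?T \<longleftrightarrow> u \<bullet> v \<noteq> 0" if "v \<in> ?S" for v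
  proof -
    have "veronese v \<in> ?T \<longleftrightarrow> 0 < q (veronese v)"
      using that by blast
    then show ?thesis
      by (simp add: q_veronese)
  qed
  have 3: "\<Union>{?V 1, ?V (-1)} = ?S \<inter> veronese -` ?T"
  proof (rule Set.set_eqI)
    fix v
    have "v \<in> ?S \<inter> veronese -` ?T \<longleftrightarrow> v \<in> ?S \<and> u \<bullet> v \<noteq> 0"
      using T_iff[of v] by blast
    then show "v \<in> \<Union>{?V 1, ?V (-1)} \<longleftrightarrow> v \<in> ?S \<inter> veronese -` ?T"
      by (simp only:) auto
  qed
  have 4: "openin (top_of_set ?S) (?V e)" for e
  proof -
    have "?V e = ?S \<inter> (\<lambda>v. e * (u \<bullet> v)) -` {0<..}"
      by auto
    then show ?thesis
      by (auto intro!: continuous_openin_preimage_gen continuous_intros)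
  qed
  have 5: "homeomorphism (?V e) ?T veronese (\<lambda>N. e *\<^sub>R sgn (N *v u))" if e: "e = 1 \<or> e = -1" for e
  proof (rule homeomorphismI)
    have ee: "e * e = 1" "e * (e * c) = c" for c
      using e by auto
    have inv: "e *\<^sub>R sgn (veronese v *v u) = v" if v: "v \<in> ?V e" for v
    proof -
      have "sgn (u \<bullet> v) = e"
        using v e by auto
      then show ?thesis
        using v ee by (simp add: veronese_mult_vec sgn_scaleR sgn_div_norm[of v])
    qed
    then show "e *\<^sub>R sgn (veronese v *v u) = v" if "v \<in> ?V e" for v
      using that .
    have im: "veronese ` ?V e = ?T"
    proof
      show "veronese ` ?V e \<subseteq> ?T"
        by (auto simp: q_veronese)
      show "?T \<subseteq> veronese ` ?V e"
      proof
        fix N assume "N \<in> ?T"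
        then obtain v where v: "norm v = 1" "N = veronese v" "u \<bullet> v \<noteq> 0"
          by (auto simp: q_veronese)
        \<comment> \<open>The representative of the antipodal pair in the hemisphere selected by \<open>e\<close>.\<close>
        define w where "w = (if 0 < e * (u \<bullet> v) then v else - v)"
        have "w \<in> ?V e"
          using v e by (auto simp: w_def)
        moreover have "N = veronese w"
          using v veronese_eq_iff[of v w] by (auto simp: w_def)
        ultimately show "N \<in> veronese ` ?V e"
          by blast
      qed
    qed
    then show "veronese ` ?V e \<subseteq> ?T"
      by simp
    show "veronese (e *\<^sub>R sgn (N *v u)) = N" if "N \<in> ?T" for N
    proof -
      have "N \<in> veronese ` ?V e"
        using that by (simp only: im)
      then obtain v where v: "v \<in> ?V e" "N = veronese v"
        by blast
      show ?thesis
        by (simp only: v(2) inv[OF v(1)])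
    qed
    show "(\<lambda>N. e *\<^sub>R sgn (N *v u)) ` ?T \<subseteq> ?V e"
    proof (rule image_subsetI)
      fix N assume "N \<in> ?T"
      then have "N \<in> veronese ` ?V e"
        by (simp only: im)
      then obtain v where v: "v \<in> ?V e" "N = veronese v"
        by blast
      show "e *\<^sub>R sgn (N *v u) \<in> ?V e"
        using v(1) by (simp only: v(2) inv[OF v(1)])
    qed
    show "continuous_on (?V e) veronese"
      by (rule continuous_on_veronese)
    show "continuous_on ?T (\<lambda>N. e *\<^sub>R sgn (N *v u))"
      by (intro continuous_intros cont) (auto simp: q_def)
  qed
  show "\<exists>T. M \<in> T \<and> openin (top_of_set ?P) T \<and>
      (\<exists>\<V>. \<Union>\<V> = ?S \<inter> veronese -` T \<and> (\<forall>U\<in>\<V>. openin (top_of_set ?S) U) \<and>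
        pairwise disjnt \<V> \<and> (\<forall>U\<in>\<V>. \<exists>q. homeomorphism U T veronese q))"
  proof (intro exI[of _ ?T] exI[of _ "{?V 1, ?V (-1)}"] conjI)
    show "\<forall>U\<in>{?V 1, ?V (-1)}. openin (top_of_set ?S) U"
      using 4[of 1] 4[of "-1"] by blast
    show "\<forall>U\<in>{?V 1, ?V (-1)}. \<exists>q. homeomorphism U ?T veronese q"
      using 5[of 1] 5[of "-1"] by blast
    show "pairwise disjnt {?V 1, ?V (-1)}"
      by (auto simp: pairwise_def disjnt_def)
  qed (use 1 2 3 in auto)
qed simp

lemma antipodal_class_eq_iff: "antipodal_class v = antipodal_class w \<longleftrightarrow> v = w \<or> v = - w"
  by (auto simp: antipodal_class_def doubleton_eq_iff)

text \<open>The map \<open>veronese\<close> identifies exactly the antipodal pairs, so it embeds the projective plane in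
  the space of matrices; lifting problems along \<open>antipodal_class\<close> become lifting problems along
  \<open>veronese\<close>, which is a covering of subsets of normed spaces.\<close>

lemma RP2_embedding:
  obtains \<phi> where "continuous_map RP2 (top_of_set (veronese ` S2)) \<phi>"
    and "\<And>v. v \<in> S2 \<Longrightarrow> \<phi> (antipodal_class v) = veronese v"
proof
  let ?\<phi> = "\<lambda>A. veronese (SOME v. v \<in> A)"
  show eq: "?\<phi> (antipodal_class v) = veronese v" if "v \<in> S2" for v
  proof -
    have "(SOME w. w \<in> antipodal_class v) \<in> antipodal_class v"
      by (rule someI[of _ v]) (simp add: antipodal_class_def)
    then show ?thesis
      by (auto simp: antipodal_class_def veronese_def vec_eq_iff)
  qed
  have "continuous_map (top_of_set S2) (top_of_set (veronese ` S2)) (?\<phi> \<circ> antipodal_class)"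
    by (rule continuous_map_eq[of _ _ veronese]) (auto simp: continuous_on_veronese eq)
  then show "continuous_map RP2 (top_of_set (veronese ` S2)) ?\<phi>"
    by (rule continuous_compose_quotient_map[OF quotient_map_antipodal_class])
qed

lemma continuous_map_antipodal_class: "continuous_map (top_of_set S2) RP2 antipodal_class"
  by (rule quotient_imp_continuous_map[OF quotient_map_antipodal_class])

lemma lift_path_RP2:
  assumes \<gamma>: "pathin RP2 \<gamma>" and a: "a \<in> S2" "\<gamma> 0 = antipodal_class a"
  obtains g where "path g" "path_image g \<subseteq> S2" "pathstart g = a"
    "\<And>r. r \<in> {0..1} \<Longrightarrow> antipodal_class (g r) = \<gamma> r"
proof -
  obtain \<phi> where \<phi>: "continuous_map RP2 (top_of_set (veronese ` S2)) \<phi>"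
    "\<And>v. v \<in> S2 \<Longrightarrow> \<phi> (antipodal_class v) = veronese v"
    using RP2_embedding by blast
  have "continuous_map (top_of_set {0..1}) (top_of_set (veronese ` S2)) (\<phi> \<circ> \<gamma>)"
    using \<gamma> \<phi>(1) unfolding pathin_def by (rule continuous_map_compose)
  then have "path (\<phi> \<circ> \<gamma>)" "path_image (\<phi> \<circ> \<gamma>) \<subseteq> veronese ` S2"
    by (auto simp: path_def path_image_def o_def)
  moreover have "pathstart (\<phi> \<circ> \<gamma>) = veronese a"
    using \<phi>(2)[OF a(1)] by (simp add: pathstart_def a(2))
  ultimately obtain g where g: "path g" "path_image g \<subseteq> S2" "pathstart g = a"
    "\<And>r. r \<in> {0..1} \<Longrightarrow> veronese (g r) = (\<phi> \<circ> \<gamma>) r"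
    using covering_space_lift_path_strong[OF covering_space_veronese a(1)] by blast
  show ?thesis
  proof (rule that[OF g(1-3)])
    fix r :: real assume r: "r \<in> {0..1}"
    obtain v where v: "v \<in> S2" "\<gamma> r = antipodal_class v"
      using continuous_map_image_subset_topspace[OF \<gamma>[unfolded pathin_def]] r
      unfolding topspace_RP2 topspace_euclidean_subtopology by blast
    have "g r \<in> S2"
      using g(2) r unfolding path_image_def by blast
    then show "antipodal_class (g r) = \<gamma> r"
      using g(4)[OF r] v by (auto simp: \<phi>(2) antipodal_class_eq_iff veronese_eq_iff)
  qed
qed

text \<open>A copy of the cube inside a normed space, where covering space theory applies. The bounded
  functions on \<open>nat\<close> with the supremum norm have room for the cubes of all dimensions at once.\<close>

lemma cube_embeds_in_normed_space:
  obtains E :: "(nat \<Rightarrow> real) \<Rightarrow> (nat \<Rightarrow>\<^sub>C real)" and D where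
    "continuous_map (cube k) euclidean E"
    "continuous_map (top_of_set (E ` topspace (cube k))) (cube k) D"
    "\<And>t. t \<in> topspace (cube k) \<Longrightarrow> D (E t) = t"
proof
  define e :: "nat \<Rightarrow> (nat \<Rightarrow>\<^sub>C real)" where "e i = Bcontfun (indicator {i})" for i
  let ?E = "\<lambda>t. \<Sum>i\<in>{1..k}. t i *\<^sub>R e i"
  let ?D = "\<lambda>u. \<lambda>i\<in>{1..k}. apply_bcontfun u i"
  have e: "apply_bcontfun (e i) j = indicator {i} j" for i j
  proof -
    have "range (indicator {i} :: nat \<Rightarrow> real) \<subseteq> {0..1}"
      by (auto simp: indicator_def)
    then have "(indicator {i} :: nat \<Rightarrow> real) \<in> bcontfun"
      by (auto simp: bcontfun_def intro: bounded_subset[OF bounded_closed_interval])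
    then show ?thesis
      by (simp add: e_def Bcontfun_inverse)
  qed
  have sum: "apply_bcontfun (\<Sum>i\<in>I. F i) j = (\<Sum>i\<in>I. apply_bcontfun (F i) j)"
    for I :: "nat set" and F :: "nat \<Rightarrow> (nat \<Rightarrow>\<^sub>C real)" and j
    by (induction I rule: infinite_finite_induct) auto
  show "continuous_map (cube k) euclidean ?E"
  proof (rule continuous_map_sum)
    show "continuous_map (cube k) euclidean (\<lambda>t. t i *\<^sub>R e i)" if "i \<in> {1..k}" for i
      using continuous_map_cube_coordinate[OF that] by (simp add: continuous_map_atin tendsto_intros)
  qed simp
  show DE: "?D (?E t) = t" if "t \<in> topspace (cube k)" for t
    using that by (auto simp: topspace_cube PiE_def extensional_def fun_eq_iff sum e indicator_def
        if_distrib[of "(*) _"] cong: if_cong)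
  show "continuous_map (top_of_set (?E ` topspace (cube k))) (cube k) ?D"
    unfolding continuous_map_into_cube
  proof (intro conjI ballI)
    show "?D \<in> topspace (top_of_set (?E ` topspace (cube k))) \<rightarrow> topspace (cube k)"
      using DE by auto
    have "continuous_on A (\<lambda>u. apply_bcontfun u i)" for A :: "(nat \<Rightarrow>\<^sub>C real) set" and i
      unfolding continuous_on_iff using dist_fun_lt_imp_dist_val_lt by blast
    then show "continuous_map (top_of_set (?E ` topspace (cube k))) euclideanreal (\<lambda>u. ?D u i)"
      if "i \<in> {1..k}" for i
      unfolding restrict_apply'[OF that] by simp
  qed
qed

lemma cube_map_homotopic_constant:
  assumes "continuous_map (cube k) X f"
  shows "homotopic_with (\<lambda>_. True) (cube k) X f (\<lambda>_. f (\<lambda>i\<in>{1..k}. 0))"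
proof -
  let ?o = "\<lambda>i\<in>{1..k}. 0 :: real"
  let ?W = "prod_topology (top_of_set {0..1::real}) (cube k)"
  have o: "?o \<in> topspace (cube k)"
    by (simp add: topspace_cube)
  have "continuous_map ?W (cube k) (\<lambda>w. cube_segment k (snd w) ?o (fst w))"
    by (intro continuous_map_cube_segment continuous_map_fst continuous_map_snd) (use o in simp)
  from continuous_map_compose[OF this assms]
  have "homotopic_with (\<lambda>_. True) (cube k) X (\<lambda>t. f (cube_segment k t ?o 0)) (\<lambda>t. f (cube_segment k t ?o 1))"
    unfolding homotopic_with_def
    by (intro exI[of _ "f \<circ> (\<lambda>w. cube_segment k (snd w) ?o (fst w))"]) simp
  then show ?thesis
    by (rule homotopic_with_eq) (simp_all add: cube_segment_ends[OF _ o] del: One_nat_def)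
qed

text \<open>A map on a cube is null-homotopic, and null-homotopic maps lift through coverings.\<close>

lemma lift_cube_RP2:
  assumes f: "continuous_map (cube k) RP2 f"
  obtains g where "continuous_map (cube k) (top_of_set S2) g"
    "\<And>t. t \<in> topspace (cube k) \<Longrightarrow> antipodal_class (g t) = f t"
proof -
  obtain \<phi> where \<phi>: "continuous_map RP2 (top_of_set (veronese ` S2)) \<phi>"
    "\<And>v. v \<in> S2 \<Longrightarrow> \<phi> (antipodal_class v) = veronese v"
    using RP2_embedding by blast
  obtain E :: "(nat \<Rightarrow> real) \<Rightarrow> (nat \<Rightarrow>\<^sub>C real)" and D where
    E: "continuous_map (cube k) euclidean E" and
    D: "continuous_map (top_of_set (E ` topspace (cube k))) (cube k) D" and
    DE: "\<And>t. t \<in> topspace (cube k) \<Longrightarrow> D (E t) = t"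
    using cube_embeds_in_normed_space by blast
  let ?U = "E ` topspace (cube k)" and ?c = "f (\<lambda>i\<in>{1..k}. 0)"
  have "homotopic_with (\<lambda>_. True) (cube k) (top_of_set (veronese ` S2)) (\<phi> \<circ> f) (\<phi> \<circ> (\<lambda>_. ?c))"
    by (rule homotopic_with_compose_continuous_map_left[OF cube_map_homotopic_constant[OF f] \<phi>(1)]) simp
  then have "homotopic_with_canon (\<lambda>_. True) ?U (veronese ` S2) (\<phi> \<circ> f \<circ> D) (\<phi> \<circ> (\<lambda>_. ?c) \<circ> D)"
    by (rule homotopic_with_compose_continuous_map_right[OF _ D]) simp
  then obtain h where h: "continuous_on ?U h" "h ` ?U \<subseteq> S2"
    "\<And>y. y \<in> ?U \<Longrightarrow> veronese (h y) = (\<phi> \<circ> f \<circ> D) y"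
    using covering_space_lift_inessential_function[OF covering_space_veronese, of ?U "\<phi> \<circ> f \<circ> D" "\<phi> ?c"]
    by (auto simp: o_def)
  show ?thesis
  proof (rule that[of "h \<circ> E"])
    have "continuous_map (cube k) (top_of_set ?U) E"
      using E by (simp add: continuous_map_in_subtopology)
    moreover have "continuous_map (top_of_set ?U) (top_of_set S2) h"
      using h by auto
    ultimately show "continuous_map (cube k) (top_of_set S2) (h \<circ> E)"
      by (rule continuous_map_compose)
    fix t assume t: "t \<in> topspace (cube k)"
    then obtain v where v: "v \<in> S2" "f t = antipodal_class v"
      using continuous_map_image_subset_topspace[OF f] unfolding topspace_RP2 by blast
    have "h (E t) \<in> S2"
      using h(2) t by blast
    then show "antipodal_class ((h \<circ> E) t) = f t"
      using h(3)[of "E t"] t v by (auto simp: DE \<phi>(2) antipodal_class_eq_iff veronese_eq_iff)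
  qed
qed

section \<open>Coordinate projections of configurations in the projective plane\<close>

text \<open>Lift \<open>f\<close>, \<open>g\<close> and \<open>\<gamma>\<close> to the sphere. The boundary of the cube is connected as \<open>k \<ge> 2\<close>, so the lifts of
  the spheroids are constant on it, with one value out of an antipodal pair, and are spheroids again.
  The lifted path starts at the basepoint of the lift of \<open>f\<close> and ends at plus or minus the basepoint
  of the lift of \<open>g\<close>; negating the latter lift if necessary, it ends at the basepoint itself. Either
  sign is admissible, since different points of the projective plane have lifts that are neither
  equal nor antipodal. This is why the path \<open>\<gamma>\<close> is arbitrary.\<close>

proposition shell_RP2_homotopic:
  assumes k: "2 \<le> k"
    and f: "f \<in> spheroids k RP2 a" and g: "g \<in> spheroids k RP2 b"
    and fg: "\<And>t. t \<in> topspace (cube k) \<Longrightarrow> f t \<noteq> g t"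
    and \<gamma>: "pathin RP2 \<gamma>" "\<gamma> 0 = a" "\<gamma> 1 = b"
  shows "spheroid_homotopic k RP2 b (shell k \<gamma> f) g"
proof -
  let ?S = "top_of_set S2" and ?o = "\<lambda>i\<in>{1..k}. 0 :: real"
  have k1: "1 \<le> k"
    using k by simp
  have o: "?o \<in> cube_boundary k" "?o \<in> topspace (cube k)"
    using origin_in_cube_boundary[OF k1] cube_boundary_subset by blast+
  have lift: "\<exists>u. u \<in> spheroids k ?S (u ?o) \<and> (\<forall>t\<in>topspace (cube k). antipodal_class (u t) = h t)"
    if h: "h \<in> spheroids k RP2 c" for h c
  proof -
    obtain u where u: "continuous_map (cube k) ?S u"
      "\<And>t. t \<in> topspace (cube k) \<Longrightarrow> antipodal_class (u t) = h t"
      using h lift_cube_RP2 unfolding spheroids_def by blast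
    have "connected (u ` cube_boundary k)"
      using connectedin_continuous_map_image[OF u(1) connectedin_cube_boundary[OF k]]
      by (simp add: connectedin_subtopology)
    moreover have "u ` cube_boundary k \<subseteq> {u ?o, - u ?o}"
    proof (rule image_subsetI)
      fix t assume t: "t \<in> cube_boundary k"
      then have "h t = c" "h ?o = c" "t \<in> topspace (cube k)"
        using o h cube_boundary_subset by (auto simp: spheroids_def)
      then have "antipodal_class (u t) = antipodal_class (u ?o)"
        using u(2) o(2) by metis
      then show "u t \<in> {u ?o, - u ?o}"
        by (simp add: antipodal_class_eq_iff)
    qed
    ultimately obtain p where "u ` cube_boundary k \<subseteq> {p}"
      using connected_finite_iff_sing finite_subset[of _ "{u ?o, - u ?o}"]
      by (metis finite.simps empty_subsetI order_refl)
    then have "u ` cube_boundary k \<subseteq> {u ?o}"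
      using o(1) by blast
    then show ?thesis
      using u by (auto simp: spheroids_def)
  qed
  obtain u where u: "u \<in> spheroids k ?S (u ?o)"
    "\<And>t. t \<in> topspace (cube k) \<Longrightarrow> antipodal_class (u t) = f t"
    using lift[OF f] by blast
  obtain v where v: "v \<in> spheroids k ?S (v ?o)"
    "\<And>t. t \<in> topspace (cube k) \<Longrightarrow> antipodal_class (v t) = g t"
    using lift[OF g] by blast
  have S: "u t \<in> S2" "v t \<in> S2" if "t \<in> topspace (cube k)" for t
    using u(1) v(1) that by (auto simp: spheroids_def continuous_map_in_subtopology)
  have qa: "antipodal_class (u ?o) = a" and qb: "antipodal_class (v ?o) = b"
    using u(2)[OF o(2)] v(2)[OF o(2)] f g o(1) by (auto simp: spheroids_def)
  obtain \<delta> where \<delta>: "path \<delta>" "path_image \<delta> \<subseteq> S2" "pathstart \<delta> = u ?o"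
    "\<And>r. r \<in> {0..1} \<Longrightarrow> antipodal_class (\<delta> r) = \<gamma> r"
    using lift_path_RP2[OF \<gamma>(1) S(1)[OF o(2)]] \<gamma>(2) qa by metis
  have "antipodal_class (pathfinish \<delta>) = antipodal_class (v ?o)"
    using \<delta>(4)[of 1] \<gamma>(3) qb by (simp add: pathfinish_def)
  then consider "pathfinish \<delta> = v ?o" | "pathfinish \<delta> = - v ?o"
    by (auto simp: antipodal_class_eq_iff)
  \<comment> \<open>The lift of \<open>g\<close> whose basepoint is the end of the lifted path.\<close>
  then obtain w where w: "w \<in> spheroids k ?S (pathfinish \<delta>)"
    "\<And>t. t \<in> topspace (cube k) \<Longrightarrow> antipodal_class (w t) = g t"
  proof cases
    case 1
    then show ?thesis
      using that v by metis
  next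
    case 2
    show ?thesis
    proof (rule that[of "\<lambda>t. - v t"])
      show "(\<lambda>t. - v t) \<in> spheroids k ?S (pathfinish \<delta>)"
        using v(1) 2 by (auto simp: spheroids_def continuous_map_in_subtopology)
      show "antipodal_class (- v t) = g t" if "t \<in> topspace (cube k)" for t
        using v(2)[OF that] antipodal_class_eq_iff[of "- v t" "v t"] by simp
    qed
  qed
  have "u t \<noteq> - w t" if t: "t \<in> topspace (cube k)" for t
    using u(2)[OF t] w(2)[OF t] fg[OF t] by (metis antipodal_class_eq_iff)
  then have "spheroid_homotopic k ?S (pathfinish \<delta>) (shell k \<delta> u) w"
    using shell_homotopic_nowhere_antipodal[OF _ k1 u(1) w(1) _ \<delta>(1-3)] by simp
  then have "spheroid_homotopic k RP2 b (antipodal_class \<circ> shell k \<delta> u) (antipodal_class \<circ> w)"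
  proof (rule homotopic_with_compose_continuous_map_left[OF _ continuous_map_antipodal_class])
    fix h assume "h ` cube_boundary k \<subseteq> {pathfinish \<delta>}"
    then show "(antipodal_class \<circ> h) ` cube_boundary k \<subseteq> {b}"
      using \<delta>(4)[of 1] \<gamma>(3) by (auto simp: pathfinish_def)
  qed
  then show ?thesis
  proof (rule homotopic_with_eq)
    show "shell k \<gamma> f t = (antipodal_class \<circ> shell k \<delta> u) t" if t: "t \<in> topspace (cube k)" for t
    proof -
      have "antipodal_class (shell k \<delta> u t) = shell k (antipodal_class \<circ> \<delta>) (antipodal_class \<circ> u) t"
        by (simp add: shell_def)
      also have "\<dots> = shell k \<gamma> f t"
        using u(2) \<delta>(4) by (intro shell_cong k1 t) auto
      finally show ?thesis
        by simp
    qed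
    show "g t = (antipodal_class \<circ> w) t" if "t \<in> topspace (cube k)" for t
      using w(2)[OF that] by simp
    show "h ` cube_boundary k \<subseteq> {b} \<longleftrightarrow> h' ` cube_boundary k \<subseteq> {b}"
      if "\<And>t. t \<in> topspace (cube k) \<Longrightarrow> h t = h' t" for h h' :: "(nat \<Rightarrow> real) \<Rightarrow> (real^3) set"
      using that cube_boundary_subset by (metis (no_types, lifting) image_cong subsetD)
  qed
qed

lemma continuous_map_config_coordinate:
  assumes "i \<in> {1..n}"
  shows "continuous_map (config_space n X) X (\<lambda>y. y i)"
  unfolding config_space_def power_space_def
  by (intro continuous_map_from_subtopology continuous_map_product_projection assms)

text \<open>Distinct coordinates of a configuration never meet, so two coordinate projections of a spheroid
  satisfy the hypothesis of \<open>shell_RP2_homotopic\<close>.\<close>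

lemma diagonal_on_pi_RP2:
  assumes k: "2 \<le> k"
  shows "diagonal_on_pi n k RP2 x"
  unfolding diagonal_on_pi_def
proof (intro allI impI ballI)
  fix i j \<gamma> A
  assume *: "1 \<le> i \<and> i < j \<and> j \<le> n \<and> pathin RP2 \<gamma> \<and> \<gamma> 0 = x i \<and> \<gamma> 1 = x j"
    and A: "A \<in> carrier (pi_group k (config_space n RP2) x)"
  have ij: "i \<in> {1..n}" "j \<in> {1..n}" "i \<noteq> j" and \<gamma>: "pathin RP2 \<gamma>" "\<gamma> 0 = x i" "\<gamma> 1 = x j"
    using * by auto
  obtain f where f: "f \<in> spheroids k (config_space n RP2) x" "A = pi_class k (config_space n RP2) x f"
    using A by (auto simp: carrier_pi_group)
  let ?p = "\<lambda>m. (\<lambda>y. y m) \<circ> f"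
  have p: "?p m \<in> spheroids k RP2 (x m)"
    and pA: "pi_map k RP2 (\<lambda>y. y m) x A = pi_class k RP2 (x m) (?p m)" if "m \<in> {1..n}" for m
    using compose_spheroids[OF continuous_map_config_coordinate[OF that] f(1)]
      pi_map_pi_class[OF continuous_map_config_coordinate[OF that] f(1)] f(2) by auto
  have "?p i t \<noteq> ?p j t" if t: "t \<in> topspace (cube k)" for t
  proof -
    have "f t \<in> topspace (config_space n RP2)"
      using f(1) t continuous_map_image_subset_topspace by (fastforce simp: spheroids_def)
    then have "inj_on (f t) {1..n}"
      by (simp add: config_space_def)
    then show ?thesis
      using ij by (auto dest: inj_onD)
  qed
  from shell_RP2_homotopic[OF k p[OF ij(1)] p[OF ij(2)] this \<gamma>]
  have "pi_class k RP2 (x j) (shell k \<gamma> (?p i)) = pi_class k RP2 (x j) (?p j)"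
    by (rule pi_class_eqI)
  moreover have "change_basepoint k RP2 \<gamma> (pi_class k RP2 (x i) (?p i))
      = pi_class k RP2 (x j) (shell k \<gamma> (?p i))"
    using change_basepoint_pi_class[of k "?p i" RP2 \<gamma>] k p[OF ij(1)] \<gamma> by simp
  ultimately show "change_basepoint k RP2 \<gamma> (pi_map k RP2 (\<lambda>y. y i) x A) = pi_map k RP2 (\<lambda>y. y j) x A"
    by (simp only: pA[OF ij(1)] pA[OF ij(2)])
qed

theorem proposition10:
  fixes n k :: nat and x :: "nat \<Rightarrow> (real^3) set"
  assumes "n \<ge> 2" and "k \<ge> 2"
    and "x \<in> topspace (config_space n RP2)"
  shows "pi_map k (power_space n RP2) id x
           \<in> hom (pi_group k (config_space n RP2) x) (pi_group k (power_space n RP2) x)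
         \<and> diagonal_on_pi n k RP2 x"
proof
  have "continuous_map (config_space n RP2) (power_space n RP2) id"
    by (simp add: config_space_def continuous_map_from_subtopology)
  from pi_map_hom[OF _ this, of k x] show "pi_map k (power_space n RP2) id x
      \<in> hom (pi_group k (config_space n RP2) x) (pi_group k (power_space n RP2) x)"
    using assms(2) by simp
  show "diagonal_on_pi n k RP2 x"
    by (rule diagonal_on_pi_RP2[OF assms(2)])
qed

end
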